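(* Let $n\ge 1$. (i) Let $\mathcal{A}_m\subseteq\mathcal{D}_m$ be the set of Dyck paths of size $m$ all of whose peaks are at odd height. Then $$\sum_{P\in\mathcal{A}_{n+1}}(-1)^{\mathsf{traj}(P)}=(-1)^{\lfloor\frac{n+2}{2}\rfloor}(e_n-d_n),$$ where $e_n$ (resp. $d_n$) is the number of Motzkin paths of length $n$ with an even (resp. odd) number of up steps. (ii) Let $\mathcal{B}_n\subseteq\mathcal{D}_n$ be the set of Dyck paths of size $n$ all of whose peaks are at even height. Then $$\sum_{P\in\mathcal{B}_n}(-1)^{\mathsf{traj}(P)}=(-1)^{\lfloor\frac{n+2}{2}\rfloor}(\hat d_n-\hat e_n),$$ where $\hat e_n$ (resp. $\hat d_n$) is the number of Riordan paths of length $n$ with an even (resp. odd) number of up steps.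
   Context: A Dyck path of size $n$ is a lattice path in $\mathbb{Z}^2$ from $(0,0)$ to $(n,n)$ using north steps $\mathsf{N}=(0,1)$ and east steps $\mathsf{E}=(1,0)$ that never goes below the line $y=x$; $\mathcal{D}_n$ is the set of such paths. A peak is an occurrence of two consecutive steps $\mathsf{N}\mathsf{E}$; its coordinates are those of the lattice point where its $\mathsf{N}$ and $\mathsf{E}$ meet, and it is at height $h$ if that point lies on the line $y=x+h$. For a Dyck path $P$, $-P$ is its reflection over $y=x$. For $P,Q\in\mathcal{D}_n$, the grid polygon associated with $(P,Q)$ is the region enclosed by $P$ and $-Q$; its boundary consists of the $4n$ unit steps of $P$ and $-Q$. From the midpoint of any boundary step, emit a light beam into the interior making a $45^\circ$ angle with that step; it travels straight until it reaches the midpoint of another boundary step (meeting it at $45^\circ$). This defines a permutation of the $4n$ boundary steps; $\mathsf{traj}(P,Q)$ is its number of cycles. For $P\in\mathcal{D}_n$, $\mathsf{traj}(P)=\mathsf{traj}(P,\mathsf{N}^n\mathsf{E}^n)$. A Motzkin path of length $n$ is a lattice path from $(0,0)$ to $(n,0)$ with up steps $(1,1)$, horizontal steps $(1,0)$ and down steps $(1,-1)$ that never goes below the $x$-axis (there is exactly one, the empty path, of length $0$). A Riordan path is a Motzkin path with no horizontal step on the $x$-axis. *)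

theory Defs
  imports Main "HOL-Library.Product_Plus" "HOL-Combinatorics.Orbits"
begin

section \<open>Dyck paths\<close>

datatype step = N | E

definition pos :: "step list \<Rightarrow> nat \<Rightarrow> int \<times> int" where
  "pos P k = (int (count_list (take k P) E), int (count_list (take k P) N))"

definition dyck :: "nat \<Rightarrow> step list set" where
  "dyck n = {P. length P = 2 * n \<and> pos P (2 * n) = (int n, int n) \<and>
                (\<forall>k \<le> 2 * n. fst (pos P k) \<le> snd (pos P k))}"

definition peaks :: "step list \<Rightarrow> (int \<times> int) set" where
  "peaks P = {pos P (Suc i) |i. Suc i < length P \<and> P ! i = N \<and> P ! Suc i = E}"

definition height :: "int \<times> int \<Rightarrow> int" where
  "height p = snd p - fst p"

definition dyck_odd_peaks :: "nat \<Rightarrow> step list set" where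
  "dyck_odd_peaks n = {P \<in> dyck n. \<forall>p \<in> peaks P. odd (height p)}"

definition dyck_even_peaks :: "nat \<Rightarrow> step list set" where
  "dyck_even_peaks n = {P \<in> dyck n. \<forall>p \<in> peaks P. even (height p)}"

section \<open>Grid polygons\<close>

text \<open>
  All geometry is scaled by a factor of 2, so that midpoints of unit steps and centres of
  unit cells have integer coordinates. A unit step is identified with its (doubled) midpoint,
  the sum of its two end points: (odd, even) for a horizontal step, (even, odd) for a vertical
  one. A unit cell is identified with its (doubled) centre, which is (odd, odd).
\<close>

definition steps_of :: "step list \<Rightarrow> (int \<times> int) set" where
  "steps_of P = {pos P k + pos P (Suc k) |k. k < length P}"

fun swap_step :: "step \<Rightarrow> step" where
  "swap_step N = E"
| "swap_step E = N"

definition reflect :: "step list \<Rightarrow> step list" where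
  "reflect P = map swap_step P"

definition boundary :: "step list \<Rightarrow> step list \<Rightarrow> (int \<times> int) set" where
  "boundary P Q = steps_of P \<union> steps_of (reflect Q)"

text \<open>The cells strictly between the east steps of \<open>P\<close> and \<open>-Q\<close> in their column.\<close>

definition interior_cells :: "step list \<Rightarrow> step list \<Rightarrow> (int \<times> int) set" where
  "interior_cells P Q = {(x, y). odd x \<and> odd y \<and>
     (\<exists>t > y. (x, t) \<in> steps_of P) \<and> (\<exists>b < y. (x, b) \<in> steps_of (reflect Q))}"

definition inward_normal :: "step list \<Rightarrow> step list \<Rightarrow> int \<times> int \<Rightarrow> int \<times> int" where
  "inward_normal P Q s =
     (THE v. v \<in> {(1, 0), (-1, 0), (0, 1), (0, -1)} \<and> s + v \<in> interior_cells P Q)"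

section \<open>Light beams\<close>

text \<open>
  At every boundary step there are two inward directions at 45 degrees, \<open>v + w\<close> and \<open>v - w\<close>,
  where \<open>v\<close> is the inward normal and \<open>w\<close> is \<open>v\<close> rotated by +90 degrees. One of them belongs to
  the beam that is emitted, the other to the beam that arrives, and they have to be chosen so
  that an arriving beam leaves along its mirror image. This is achieved by a chessboard rule:
  beams turn clockwise about the centre of a cell whose lower left corner \<open>(i, j)\<close> has
  \<open>i + j\<close> even, and anticlockwise about the others; the rule is respected by a beam
  passing straight into the next cell. In doubled coordinates the centre \<open>(2i+1, 2j+1)\<close> has
  \<open>i + j\<close> even iff its coordinate sum is 2 modulo 4. Reversing all
  directions, or those on single trajectories, inverts cycles and leaves their number unchanged.
\<close>

fun rot90 :: "int \<times> int \<Rightarrow> int \<times> int" where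
  "rot90 (x, y) = (- y, x)"

definition turn :: "int \<times> int \<Rightarrow> int \<times> int \<Rightarrow> int \<times> int" where
  "turn s v = (if (fst (s + v) + snd (s + v)) mod 4 = 2 then v + rot90 v else v - rot90 v)"

definition beam_dir :: "step list \<Rightarrow> step list \<Rightarrow> int \<times> int \<Rightarrow> int \<times> int" where
  "beam_dir P Q s = turn s (inward_normal P Q s)"

fun along :: "int \<times> int \<Rightarrow> int \<times> int \<Rightarrow> nat \<Rightarrow> int \<times> int" where
  "along (x, y) (a, b) k = (x + int k * a, y + int k * b)"

text \<open>
  The law of reflection for the chessboard rule: a beam sent from \<open>s\<close> that meets a step \<open>t\<close>
  with inward normal \<open>v'\<close> from the inner side (so that its direction \<open>d\<close> has inner product -1
  with \<open>v'\<close>) leaves \<open>t\<close> in direction \<open>d + 2 v'\<close>, the mirror image of \<open>d\<close>.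
\<close>

lemma turn_reflection:
  assumes "v \<in> {(1, 0), (-1, 0), (0, 1), (0, -1)}" "v' \<in> {(1, 0), (-1, 0), (0, 1), (0, -1)}"
    and "odd (fst (s + v))" "odd (snd (s + v))"
    and "t = along s (turn s v) k" "odd (fst (t + v'))" "odd (snd (t + v'))"
    and "fst (turn s v) * fst v' + snd (turn s v) * snd v' = -1"
  shows "turn t v' = turn s v + v' + v'"
proof -
  obtain x y where s: "s = (x, y)" by force
  define K where "K = int k"
  consider (1) "turn s v = v + rot90 v" "(fst (s + v) + snd (s + v)) mod 4 = 2"
    | (2) "turn s v = v - rot90 v" "(fst (s + v) + snd (s + v)) mod 4 \<noteq> 2"
    unfolding turn_def by presburger
  then show ?thesis
  proof cases
    case 1
    show ?thesis using assms(1-4,6-8) 1(2) unfolding assms(5) 1(1) s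
      apply (simp only: insert_iff empty_iff)
      apply (elim disjE FalseE; simp add: turn_def K_def[symmetric])
      apply presburger+
      done
  next
    case 2
    show ?thesis using assms(1-4,6-8) 2(2) unfolding assms(5) 2(1) s
      apply (simp only: insert_iff empty_iff)
      apply (elim disjE FalseE; simp add: turn_def K_def[symmetric])
      apply presburger+
      done
  qed
qed

definition billiard :: "step list \<Rightarrow> step list \<Rightarrow> int \<times> int \<Rightarrow> int \<times> int" where
  "billiard P Q s = (if s \<in> boundary P Q
     then along s (beam_dir P Q s)
            (LEAST k. k > 0 \<and> along s (beam_dir P Q s) k \<in> boundary P Q)
     else s)"

definition traj2 :: "step list \<Rightarrow> step list \<Rightarrow> nat" where
  "traj2 P Q = card (orbit (billiard P Q) ` boundary P Q)"

definition traj :: "step list \<Rightarrow> nat" where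
  "traj P = (let n = count_list P N in traj2 P (replicate n N @ replicate n E))"

section \<open>Motzkin and Riordan paths\<close>

datatype mstep = U | H | D

fun rise :: "mstep \<Rightarrow> int" where
  "rise U = 1"
| "rise H = 0"
| "rise D = -1"

definition level :: "mstep list \<Rightarrow> nat \<Rightarrow> int" where
  "level M k = sum_list (map rise (take k M))"

definition motzkin :: "nat \<Rightarrow> mstep list set" where
  "motzkin n = {M. length M = n \<and> level M n = 0 \<and> (\<forall>k \<le> n. level M k \<ge> 0)}"

definition riordan :: "nat \<Rightarrow> mstep list set" where
  "riordan n = {M \<in> motzkin n. \<forall>k < n. M ! k = H \<longrightarrow> level M k \<noteq> 0}"

definition num_even_up :: "mstep list set \<Rightarrow> nat" where
  "num_even_up S = card {M \<in> S. even (count_list M U)}"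

definition num_odd_up :: "mstep list set \<Rightarrow> nat" where
  "num_odd_up S = card {M \<in> S. odd (count_list M U)}"

end

(*
  The sign of a permutation of a set with evenly many elements is (-1)^(number of cycles). Cut
  the beams at all unit edges of the region: they become the cycles of a permutation of the
  half-edges (edge, adjacent cell), which is the product of one 4-cycle for every cell and one
  transposition for every interior edge. The number of interior edges is 2 (#cells - n), so
  (-1)^traj(P) is simply (-1)^(number of cells below P).

  A Dyck path has all peaks at odd height iff it has the form N w E where w is a sequence of pairs
  NN, EN, EE; reading these as U, H, D gives a Motzkin path. For even heights the path itself is
  such a sequence, and the Motzkin path is a Riordan path. The number of cells below the path is
  congruent modulo 2 to an explicit function of the number h of pairs EN, and h = n - 2 #U.
*)

theory Submission
  imports Defs
begin

section \<open>Orbits and signs of permutations\<close>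

text \<open>The obstacle is that one jump of \<open>billiard\<close> spans many cells, with its
  length given by a \<open>LEAST\<close>, and offers no evident factorisation. Cut into unit moves,
  it becomes the first return of \<open>trace\<close> to the half-edges on the rim. Taking first
  returns keeps the number of cycles as long as every cycle meets the set, and that holds here
  because a straight beam cannot stay inside a finite region. The chessboard rule in
  \<open>turn\<close> makes the two factors fit together. Neighbouring cells turn in opposite
  senses, so a beam that crosses an edge keeps its direction; at a rim edge nothing is crossed and
  the beam goes on around the same cell, which is exactly the reflection. The sign of a permutation
  sees the number of cycles only together with the size of the set. With four half-edges per cell
  that size is even and disappears.\<close>

lemma orbit_first_return:
  assumes ret: "\<And>x. x \<in> B \<Longrightarrow> \<exists>k>0. (f ^^ k) x \<in> B \<and> g (\<phi> x) = \<phi> ((f ^^ k) x) \<and>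
      (\<forall>j. 0 < j \<and> j < k \<longrightarrow> (f ^^ j) x \<notin> B)"
    and "x \<in> B"
  shows "orbit g (\<phi> x) = \<phi> ` (orbit f x \<inter> B)"
proof (intro equalityI subsetI)
  fix y assume "y \<in> orbit g (\<phi> x)"
  then show "y \<in> \<phi> ` (orbit f x \<inter> B)"
  proof induction
    case base
    from ret[OF \<open>x \<in> B\<close>] show ?case by (auto simp: orbit_altdef)
  next
    case (step y)
    then obtain z where z: "y = \<phi> z" "z \<in> orbit f x" "z \<in> B" by auto
    from ret[OF z(3)] obtain k where k: "(f ^^ k) z \<in> B" "g (\<phi> z) = \<phi> ((f ^^ k) z)" by blast
    then show ?case using z funpow_in_orbit[OF z(2), of k] by auto
  qed
next
  \<comment> \<open>Strong induction on \<open>m\<close>: the first return time \<open>k\<close> is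
    at most \<open>m\<close>, and the remaining \<open>m - k\<close> steps start again from a point
    of \<open>B\<close>.\<close>
  have "\<phi> ((f ^^ m) x) \<in> orbit g (\<phi> x)" if "m > 0" "x \<in> B" "(f ^^ m) x \<in> B" for m x
    using that
  proof (induction m arbitrary: x rule: less_induct)
    case (less m)
    from ret[OF less.prems(2)] obtain k where k: "k > 0" "(f ^^ k) x \<in> B"
      "g (\<phi> x) = \<phi> ((f ^^ k) x)" "\<And>j. 0 < j \<Longrightarrow> j < k \<Longrightarrow> (f ^^ j) x \<notin> B" by blast
    show ?case
    proof (cases "m = k")
      case True
      then show ?thesis using k(3) orbit.base[of g "\<phi> x"] by simp
    next
      case False
      with k(4)[of m] less.prems have "k < m" by force
      then have m: "(f ^^ m) x = (f ^^ (m - k)) ((f ^^ k) x)"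
        by (metis comp_apply funpow_add le_add_diff_inverse2 less_imp_le)
      then have "\<phi> ((f ^^ m) x) \<in> orbit g (g (\<phi> x))"
        using less.IH[of "m - k" "(f ^^ k) x"] \<open>k < m\<close> k less.prems by simp
      then show ?thesis by (rule orbit_subset)
    qed
  qed
  then show "y \<in> orbit g (\<phi> x)" if "y \<in> \<phi> ` (orbit f x \<inter> B)" for y
    using that \<open>x \<in> B\<close> by (auto simp: orbit_altdef)
qed

lemma permutes_orbit_eq:
  assumes "f permutes X" "finite X" "y \<in> orbit f x"
  shows "orbit f y = orbit f x"
proof -
  have "permutation f" using assms permutes_imp_permutation by blast
  then show ?thesis
    using assms(3) by (meson orbit_swap orbit_trans permutation_self_in_orbit subsetI subset_antisym)
qed

text \<open>A cycle of \<open>f\<close> is determined by the points of \<open>B\<close> on it, and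
  these sets, transported by \<open>\<phi>\<close>, are the cycles of \<open>g\<close>. The lemma
  serves both to delete one point in the sign formula and to pass from unit moves to whole
  beams.\<close>

lemma card_orbits_first_return:
  assumes "f permutes X" "finite X" "B \<subseteq> X" "inj_on \<phi> B"
    and hits: "\<And>x. x \<in> X \<Longrightarrow> orbit f x \<inter> B \<noteq> {}"
    and ret: "\<And>x. x \<in> B \<Longrightarrow> \<exists>k>0. (f ^^ k) x \<in> B \<and> g (\<phi> x) = \<phi> ((f ^^ k) x) \<and>
      (\<forall>j. 0 < j \<and> j < k \<longrightarrow> (f ^^ j) x \<notin> B)"
  shows "card (orbit g ` \<phi> ` B) = card (orbit f ` X)"
proof -
  note eq = permutes_orbit_eq[OF assms(1,2)]
  have X: "orbit f ` X = orbit f ` B"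
    using eq hits \<open>B \<subseteq> X\<close> by (fastforce simp: image_iff)
  have "orbit g ` \<phi> ` B = (\<lambda>Z. \<phi> ` (Z \<inter> B)) ` orbit f ` X"
    unfolding X image_image using orbit_first_return[of B f g \<phi>, OF ret] by (intro image_cong) auto
  moreover have "inj_on (\<lambda>Z. \<phi> ` (Z \<inter> B)) (orbit f ` X)"
  proof (rule inj_onI)
    fix O1 O2 assume O: "O1 \<in> orbit f ` X" "O2 \<in> orbit f ` X" "\<phi> ` (O1 \<inter> B) = \<phi> ` (O2 \<inter> B)"
    then have "O1 \<inter> B = O2 \<inter> B"
      using inj_on_image_eq_iff[OF \<open>inj_on \<phi> B\<close>] by blast
    then show "O1 = O2" using O hits eq by (smt (verit) Int_iff disjoint_iff image_iff)
  qed
  ultimately show ?thesis by (simp add: card_image)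
qed

text \<open>Bypassing a non-fixed point \<open>a\<close> changes the sign but not the number of orbits.\<close>

lemma sign_card_orbits:
  assumes "finite X" "f permutes X"
  shows "sign f = (-1) ^ (card X + card (orbit f ` X))"
  using assms
proof (induction X arbitrary: f rule: finite_induct)
  case empty
  then show ?case by simp
next
  case (insert a S)
  define p where "p = transpose a (f a) \<circ> f"
  have p: "p permutes S" unfolding p_def using insert.prems by (rule permutes_insert_lemma)
  have f: "f = transpose a (f a) \<circ> p" by (simp add: p_def fun_eq_iff)
  have "permutation p" "permutation (transpose a (f a))"
    by (auto intro: permutes_imp_permutation[OF insert.hyps(1) p] permutation_swap_id)
  then have sign: "sign f = (if a = f a then 1 else -1) * sign p"
    using sign_compose[of "transpose a (f a)" p] f sign_swap_id[of a "f a"] by metis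
  show ?case
  proof (cases "f a = a")
    case True
    then have "f = p" by (simp add: p_def)
    have "orbit f a = {a}" using True orbit_eq_singleton_iff by metis
    moreover have "orbit f x \<subseteq> S" if "x \<in> S" for x
      using that p unfolding \<open>f = p\<close> by (meson permutes_orbit_subset)
    then have "{a} \<notin> orbit f ` S" using insert.hyps(2) by fastforce
    ultimately have "card (orbit f ` insert a S) = Suc (card (orbit f ` S))"
      using insert.hyps(1) by simp
    then show ?thesis using sign True insert.IH[OF p] insert.hyps \<open>f = p\<close> by simp
  next
    case False
    note perm = insert.prems
    have "f a \<in> S" using perm False by (metis insert_iff permutes_in_image)
    have "card (orbit p ` (\<lambda>x. x) ` S) = card (orbit f ` insert a S)"
    proof (rule card_orbits_first_return[OF perm])
      fix x assume "x \<in> insert a S"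
      show "orbit f x \<inter> S \<noteq> {}"
      proof (cases "f x = a")
        case True
        then have "f a \<in> orbit f x" by (metis orbit.simps)
        then show ?thesis using \<open>f a \<in> S\<close> by blast
      next
        case False
        then have "f x \<in> S" using \<open>x \<in> insert a S\<close> permutes_in_image[OF perm, of x] by simp
        then show ?thesis using orbit.base by fastforce
      qed
    next
      fix x assume x: "x \<in> S"
      show "\<exists>k>0. (f ^^ k) x \<in> S \<and> p x = (f ^^ k) x \<and> (\<forall>j. 0 < j \<and> j < k \<longrightarrow> (f ^^ j) x \<notin> S)"
      \<comment> \<open>\<open>p\<close> follows \<open>f\<close> but skips \<open>a\<close>: the
        return to \<open>S\<close> takes two steps, by way of \<open>a\<close> to
        \<open>f a\<close>, if \<open>f x = a\<close>, and one step otherwise.\<close>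
      proof (cases "f x = a")
        case True
        then show ?thesis using \<open>f a \<in> S\<close> insert.hyps(2)
          by (intro exI[of _ 2]) (auto simp: p_def numeral_2_eq_2 less_Suc_eq)
      next
        case neq: False
        then have fx: "f x \<in> S" using x permutes_in_image[OF perm, of x] by simp
        have "f x \<noteq> f a" using perm x insert.hyps(2) by (metis permutes_inverses(2))
        then show ?thesis using fx neq
          by (intro exI[of _ 1]) (auto simp: p_def transpose_def)
      qed
    qed (use insert.hyps in auto)
    then show ?thesis using sign False insert.IH[OF p] insert.hyps by simp
  qed
qed

section \<open>Light beams in a finite set of cells\<close>

definition dirs :: "(int \<times> int) set" where
  "dirs = {(1, 0), (-1, 0), (0, 1), (0, -1)}"

lemma card_dirs: "finite dirs" "card dirs = 4"
  by (auto simp: dirs_def)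

lemma uminus_dirs: "v \<in> dirs \<Longrightarrow> - v \<in> dirs"
  by (auto simp: dirs_def)

lemma rot90_dirs: "v \<in> dirs \<Longrightarrow> rot90 v \<in> dirs" "v \<in> dirs \<Longrightarrow> - rot90 v \<in> dirs"
  by (auto simp: dirs_def)

lemma rot90_inj: "rot90 v = rot90 u \<longleftrightarrow> v = u"
  by (cases v; cases u) auto

text \<open>A half-edge \<open>(s, v)\<close> is an edge \<open>s\<close> together with the cell \<open>s + v\<close> on one of its sides.\<close>

locale cells =
  fixes C :: "(int \<times> int) set"
  assumes finite_C: "finite C"
    and odd_C: "\<And>c. c \<in> C \<Longrightarrow> odd (fst c) \<and> odd (snd c)"
begin

definition half_edges :: "((int \<times> int) \<times> (int \<times> int)) set" where
  "half_edges = {h. snd h \<in> dirs \<and> fst h + snd h \<in> C}"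

definition rim :: "((int \<times> int) \<times> (int \<times> int)) set" where
  "rim = {h \<in> half_edges. fst h - snd h \<notin> C}"

text \<open>The piece of a beam inside one cell, between two neighbouring edge midpoints; the new
  normal points to the same centre. Being the identity elsewhere makes it a permutation of
  \<open>half_edges\<close> in the sense of \<open>permutes\<close>.\<close>

fun rotate :: "(int \<times> int) \<times> (int \<times> int) \<Rightarrow> (int \<times> int) \<times> (int \<times> int)" where
  "rotate (s, v) = (if (s, v) \<in> half_edges then (s + turn s v, v - turn s v) else (s, v))"

text \<open>Leaving rim half-edges fixed encodes reflection: the next \<open>rotate\<close> stays in
  the same cell and departs in the mirror direction.\<close>

fun cross :: "(int \<times> int) \<times> (int \<times> int) \<Rightarrow> (int \<times> int) \<times> (int \<times> int)" where
  "cross (s, v) = (if (s, v) \<in> half_edges \<and> s - v \<in> C then (s, - v) else (s, v))"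

definition trace :: "(int \<times> int) \<times> (int \<times> int) \<Rightarrow> (int \<times> int) \<times> (int \<times> int)" where
  "trace = cross \<circ> rotate"

section \<open>The cycles of \<open>rotate\<close>: one for each cell\<close>

lemma half_edges_image: "half_edges = (\<lambda>(c, v). (c - v, v)) ` (C \<times> dirs)"
proof (intro equalityI subsetI)
  fix h assume h: "h \<in> half_edges"
  then have "h = (\<lambda>(c, v). (c - v, v)) (fst h + snd h, snd h)" by (simp add: prod_eq_iff)
  then show "h \<in> (\<lambda>(c, v). (c - v, v)) ` (C \<times> dirs)"
    using h by (intro image_eqI[of _ _ "(fst h + snd h, snd h)"]) (simp_all add: half_edges_def)
next
  fix h assume "h \<in> (\<lambda>(c, v). (c - v, v)) ` (C \<times> dirs)"
  then obtain c v where "h = (c - v, v)" "c \<in> C" "v \<in> dirs" by (force simp del: split_paired_Ex)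
  then show "h \<in> half_edges" by (simp add: half_edges_def)
qed

lemma finite_half_edges: "finite half_edges"
  unfolding half_edges_image using finite_C card_dirs by simp

lemma card_half_edges: "card half_edges = 4 * card C"
proof -
  have "inj_on (\<lambda>(c, v). (c - v, v)) (C \<times> dirs)" by (auto simp: inj_on_def)
  then show ?thesis
    unfolding half_edges_image using card_dirs by (simp add: card_image card_cartesian_product)
qed

lemma turn_cases:
  obtains "(fst (s + v) + snd (s + v)) mod 4 = 2" "turn s v = v + rot90 v"
  | "(fst (s + v) + snd (s + v)) mod 4 \<noteq> 2" "turn s v = v - rot90 v"
  by (cases "(fst (s + v) + snd (s + v)) mod 4 = 2") (simp_all add: turn_def)

lemma rotate_in:
  assumes "h \<in> half_edges"
  shows "rotate h \<in> half_edges"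
proof -
  obtain s v where h: "h = (s, v)" by (cases h)
  show ?thesis using assms unfolding h
    by (cases rule: turn_cases[of s v]) (simp_all add: half_edges_def rot90_dirs)
qed

lemma rotate_cell: "fst (rotate h) + snd (rotate h) = fst h + snd h"
  by (cases h) simp

lemma rotate_permutes: "rotate permutes half_edges"
proof (rule bij_imp_permutes)
  have "inj_on rotate half_edges"
  proof (rule inj_onI)
    fix h1 h2 assume h: "h1 \<in> half_edges" "h2 \<in> half_edges" "rotate h1 = rotate h2"
    obtain s v t u where [simp]: "h1 = (s, v)" "h2 = (t, u)" by (cases h1; cases h2)
    have c: "s + v = t + u" using rotate_cell[of h1] rotate_cell[of h2] h(3) by simp
    have eq: "v - turn s v = u - turn t u" using h by simp
    have "v = u"
      by (cases rule: turn_cases[of s v]; cases rule: turn_cases[of t u])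
        (use eq c in \<open>auto simp: rot90_inj\<close>)
    then show "h1 = h2" using c by simp
  qed
  then show "bij_betw rotate half_edges half_edges"
    using rotate_in finite_half_edges by (simp add: bij_betw_def endo_inj_surj image_subsetI)
qed auto

lemma orbit_rotate:
  assumes "h \<in> half_edges"
  shows "orbit rotate h = {h' \<in> half_edges. fst h' + snd h' = fst h + snd h}" (is "?L = ?R")
proof
  have "h' \<in> ?R" if "h' \<in> ?L" for h'
    using that assms by induction (simp_all only: rotate_cell rotate_in mem_Collect_eq)
  then show "?L \<subseteq> ?R" by blast
next
  \<comment> \<open>The sense of rotation depends only on the centre \<open>c\<close>, so on the
    normals \<open>rotate\<close> acts as one fixed quarter turn \<open>e\<close>, whose four powers
    reach every direction.\<close>
  have step: "\<exists>e \<in> {rot90, \<lambda>v. - rot90 v}. \<forall>v \<in> dirs. rotate (c - v, v) = (c - e v, e v)"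
    if "c \<in> C" for c
  proof (cases "(fst c + snd c) mod 4 = 2")
    case True
    then show ?thesis using that
      by (intro bexI[of _ "\<lambda>v. - rot90 v"]) (auto simp: half_edges_def turn_def)
  next
    case False
    then show ?thesis using that
      by (intro bexI[of _ rot90]) (auto simp: half_edges_def turn_def)
  qed
  show "?R \<subseteq> ?L"
  proof
    fix h' assume h': "h' \<in> ?R"
    define c where "c = fst h + snd h"
    obtain v where h: "h = (c - v, v)" "v \<in> dirs" "c \<in> C"
      using assms by (simp add: half_edges_def c_def prod_eq_iff)
    obtain u where u: "h' = (c - u, u)" "u \<in> dirs"
    proof
      show "h' = (c - snd h', snd h')" using h' by (simp add: c_def prod_eq_iff)
      show "snd h' \<in> dirs" using h' by (simp add: half_edges_def)
    qed
    from step[OF h(3)] obtain e where e: "e \<in> {rot90, \<lambda>v. - rot90 v}"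
      "\<And>v. v \<in> dirs \<Longrightarrow> rotate (c - v, v) = (c - e v, e v)" by blast
    have ed: "e v \<in> dirs" if "v \<in> dirs" for v using e(1) rot90_dirs[OF that] by blast
    have "u \<in> {e v, e (e v), e (e (e v)), e (e (e (e v)))}"
      using e(1) u(2) h(2) by (auto simp: dirs_def)
    moreover have "(c - e v, e v) \<in> ?L"
      using orbit.base[of rotate h] e(2)[OF h(2)] h(1) by simp
    moreover have "(c - e w, e w) \<in> ?L" if "(c - w, w) \<in> ?L" "w \<in> dirs" for w
      using orbit.step[OF that(1)] e(2)[OF that(2)] by simp
    ultimately show "h' \<in> ?L" unfolding u(1) using h(2) ed by blast
  qed
qed

lemma card_orbits_rotate: "card (orbit rotate ` half_edges) = card C"
proof -
  let ?F = "\<lambda>c. {h' \<in> half_edges. fst h' + snd h' = c}"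
  have mem: "(c - (1, 0), (1, 0)) \<in> ?F c" if "c \<in> C" for c
    using that by (simp add: half_edges_def dirs_def)
  have "orbit rotate ` half_edges = ?F ` (\<lambda>h. fst h + snd h) ` half_edges"
    unfolding image_image by (intro image_cong) (auto simp: orbit_rotate)
  also have "(\<lambda>h. fst h + snd h) ` half_edges = C"
  proof (intro equalityI subsetI)
    fix c assume "c \<in> C"
    then show "c \<in> (\<lambda>h. fst h + snd h) ` half_edges"
      using mem by (intro image_eqI[of _ _ "(c - (1, 0), (1, 0))"]) auto
  qed (auto simp: half_edges_def)
  finally have "orbit rotate ` half_edges = ?F ` C" .
  moreover have "inj_on ?F C"
  proof (rule inj_onI)
    fix c d assume "c \<in> C" "d \<in> C" "?F c = ?F d"
    then have "(c - (1, 0), (1, 0)) \<in> ?F d" using mem by blast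
    then show "c = d" by simp
  qed
  ultimately show ?thesis by (simp add: card_image)
qed

section \<open>The cycles of \<open>cross\<close>: one for each edge\<close>

lemma half_edge_unique:
  assumes "(s, v) \<in> half_edges" "(s, u) \<in> half_edges"
  shows "u = v \<or> u = - v"
proof -
  obtain x y where s: "s = (x, y)" by force
  \<comment> \<open>A unit vector changes the parity of one coordinate only, so \<open>s\<close> has
    exactly one even coordinate, and \<open>v\<close> and \<open>u\<close> both lie along its
    axis.\<close>
  have "odd (x + fst v)" "odd (y + snd v)" "odd (x + fst u)" "odd (y + snd u)"
    using assms odd_C[of "s + v"] odd_C[of "s + u"] by (simp_all add: half_edges_def s)
  moreover have "v \<in> dirs" "u \<in> dirs" using assms by (simp_all add: half_edges_def)
  ultimately show ?thesis by (auto simp: dirs_def)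
qed

lemma cross_in:
  assumes "h \<in> half_edges"
  shows "cross h \<in> half_edges"
proof -
  obtain s v where h: "h = (s, v)" by (cases h)
  show ?thesis using assms uminus_dirs[of v] unfolding h by (simp add: half_edges_def)
qed

lemma cross_cross: "cross (cross h) = h"
proof -
  obtain s v where h: "h = (s, v)" by (cases h)
  show ?thesis using uminus_dirs[of v] unfolding h by (simp add: half_edges_def)
qed

lemma cross_permutes: "cross permutes half_edges"
proof (rule bij_imp_permutes)
  show "bij_betw cross half_edges half_edges"
    by (rule bij_betw_byWitness[of _ cross]) (auto simp only: cross_cross cross_in)
qed auto

lemma orbit_cross:
  assumes "h \<in> half_edges"
  shows "orbit cross h = {h' \<in> half_edges. fst h' = fst h}" (is "?L = ?R")
proof
  have fst: "fst (cross h) = fst h" for h by (cases h) simp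
  have "h' \<in> ?R" if "h' \<in> ?L" for h'
    using that assms by induction (simp_all only: fst cross_in mem_Collect_eq)
  then show "?L \<subseteq> ?R" by blast
next
  show "?R \<subseteq> ?L"
  proof
    fix h' assume "h' \<in> ?R"
    obtain s v where h: "h = (s, v)" by (cases h)
    with \<open>h' \<in> ?R\<close> obtain u where h': "h' = (s, u)" "(s, u) \<in> half_edges" by (cases h') auto
    from half_edge_unique[OF assms[unfolded h] h'(2)] have "h' = h \<or> h' = cross h"
      unfolding h h' using h'(2) assms h by (auto simp: half_edges_def)
    moreover have "cross h \<in> ?L" by (rule orbit.base)
    moreover have "h \<in> ?L" using orbit.step[OF orbit.base, of cross h] by (simp add: cross_cross)
    ultimately show "h' \<in> ?L" by blast
  qed
qed

lemma card_orbits_cross: "card (orbit cross ` half_edges) = card (fst ` half_edges)"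
proof -
  let ?F = "\<lambda>s. {h' \<in> half_edges. fst h' = s}"
  have "orbit cross ` half_edges = ?F ` fst ` half_edges"
    unfolding image_image by (intro image_cong) (auto simp: orbit_cross)
  moreover have "inj_on ?F (fst ` half_edges)"
    by (rule inj_onI) blast
  ultimately show ?thesis by (simp add: card_image)
qed

lemma rim_unique: "(s, v) \<in> rim \<Longrightarrow> (s, u) \<in> half_edges \<Longrightarrow> u = v"
  using half_edge_unique[of s v u] by (auto simp: rim_def half_edges_def)

lemma inj_on_rim: "inj_on fst rim"
proof (rule inj_onI)
  fix h1 h2 :: "(int \<times> int) \<times> (int \<times> int)"
  assume "h1 \<in> rim" "h2 \<in> rim" "fst h1 = fst h2"
  then show "h1 = h2"
    using rim_unique[of "fst h1" "snd h1" "snd h2"] by (cases h1; cases h2) (auto simp: rim_def)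
qed

text \<open>Double counting of half-edges: an interior edge carries two of them, a rim edge one, and
  each cell has four.\<close>

lemma card_edges: "2 * card (fst ` half_edges) = 4 * card C + card rim"
proof -
  \<comment> \<open>One representative of each interior edge, the half-edge whose normal points
    right or up; \<open>cross\<close> yields the other one.\<close>
  define I where "I = {(s, v) \<in> half_edges. s - v \<in> C \<and> v \<in> {(1, 0), (0, 1)}}"
  have fin: "finite I" "finite rim"
    using finite_half_edges by (auto simp: I_def rim_def intro: finite_subset)
  have cross_I: "cross h = (fst h, - snd h)" if "h \<in> I" for h
    using that by (auto simp: I_def)
  have split: "half_edges = rim \<union> (I \<union> cross ` I)"
  proof (intro equalityI subsetI)
    fix h assume "h \<in> half_edges"
    moreover obtain s v where h: "h = (s, v)" by (cases h)
    ultimately have v: "v \<in> dirs" "s + v \<in> C" by (simp_all add: half_edges_def)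
    have "v \<in> {(1, 0), (0, 1)} \<or> - v \<in> {(1, 0), (0, 1)}"
      using v(1) by (auto simp: dirs_def)
    then consider "s - v \<notin> C" | "s - v \<in> C" "v \<in> {(1, 0), (0, 1)}"
      | "s - v \<in> C" "- v \<in> {(1, 0), (0, 1)}" by blast
    then show "h \<in> rim \<union> (I \<union> cross ` I)"
    proof cases
      case 3
      then have "(s, - v) \<in> I" using v uminus_dirs[of v] by (simp add: I_def half_edges_def)
      moreover have "cross (s, - v) = h" using cross_I[OF calculation] h by simp
      ultimately show ?thesis by blast
    qed (use v h in \<open>simp_all add: rim_def I_def half_edges_def\<close>)
  qed (auto simp: rim_def I_def cross_in simp del: cross.simps)
  have "(I \<union> cross ` I) \<inter> rim = {}"
    using cross_I by (fastforce simp: I_def rim_def half_edges_def simp del: cross.simps)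
  moreover have "I \<inter> cross ` I = {}"
    using cross_I by (fastforce simp: I_def simp del: cross.simps)
  moreover have "card (cross ` I) = card I"
    using permutes_inj[OF cross_permutes] by (simp add: card_image inj_on_subset)
  ultimately have cardH: "card half_edges = card rim + 2 * card I"
    unfolding split using fin by (subst card_Un_disjoint) (auto simp: card_Un_disjoint)
  have edges: "fst ` half_edges = fst ` rim \<union> fst ` I"
    unfolding split using cross_I by (auto simp: image_Un image_image simp del: cross.simps)
  have "fst ` rim \<inter> fst ` I = {}"
  proof -
    have False if "(s, v) \<in> rim" "(s, u) \<in> I" for s v u
      using that rim_unique[of s v u] by (auto simp: I_def rim_def)
    then show ?thesis by fastforce
  qed
  moreover have "inj_on fst I"
  proof (rule inj_onI)
    fix h1 h2 assume "h1 \<in> I" "h2 \<in> I" "fst h1 = fst h2"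
    then show "h1 = h2"
      using half_edge_unique[of "fst h1" "snd h1" "snd h2"] by (cases h1; cases h2) (auto simp: I_def)
  qed
  ultimately have "card (fst ` half_edges) = card rim + card I"
    unfolding edges using fin inj_on_rim by (simp add: card_Un_disjoint card_image)
  then show ?thesis using cardH card_half_edges by simp
qed

section \<open>Parity of the number of closed beams\<close>

lemma trace_permutes: "trace permutes half_edges"
  unfolding trace_def by (rule permutes_compose[OF rotate_permutes cross_permutes])

text \<open>The sign is multiplicative, and it equals (-1) to the number of cycles for all three
  permutations because 4 divides \<open>card half_edges\<close>. The cycles of \<open>cross\<close>
  include the rim edges, as fixed points.\<close>

lemma card_orbits_trace:
  "(-1 :: int) ^ card (orbit trace ` half_edges) = (-1) ^ (card C + card (fst ` half_edges))"
proof -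
  note perm = permutes_imp_permutation[OF finite_half_edges]
  have even: "even (card half_edges)" by (simp add: card_half_edges)
  have sgn: "sign f = (-1) ^ card (orbit f ` half_edges)" if "f permutes half_edges" for f
    using sign_card_orbits[OF finite_half_edges that] even by (simp add: power_add)
  have "sign trace = sign cross * sign rotate"
    unfolding trace_def using perm cross_permutes rotate_permutes by (intro sign_compose) auto
  then show ?thesis
    using sgn[OF trace_permutes] sgn[OF cross_permutes] sgn[OF rotate_permutes]
    by (simp add: card_orbits_rotate card_orbits_cross power_add mult.commute)
qed

lemma fst_trace: "(s, v) \<in> half_edges \<Longrightarrow> fst (trace (s, v)) = s + turn s v"
  by (auto simp: trace_def)

text \<open>The centres of two cells with a common edge differ by 2 in one coordinate, so their
  coordinate sums differ by 2 modulo 4 and the senses of rotation are opposite. Opposite sense and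
  opposite normal together preserve the direction.\<close>

lemma trace_straight:
  assumes "(s, v) \<in> half_edges" "s + turn s v \<notin> fst ` rim"
  shows "turn (s + turn s v) (snd (trace (s, v))) = turn s v"
proof -
  define t w where "t = s + turn s v" and "w = v - turn s v"
  have tw: "(t, w) \<in> half_edges" using rotate_in[OF assms(1)] assms(1) by (simp add: t_def w_def)
  have "(t, w) \<notin> rim" using assms(2) unfolding t_def[symmetric] by force
  then have "t - w \<in> C" using tw by (simp add: rim_def)
  then have "trace (s, v) = (t, - w)" using assms(1) tw by (simp add: trace_def t_def w_def)
  moreover have "turn t (- w) = turn s v"
  proof -
    have v: "v \<in> dirs" and c: "odd (fst (s + v))" "odd (snd (s + v))"
      using assms(1) odd_C[of "s + v"] by (simp_all add: half_edges_def)
    obtain x y where s: "s = (x, y)" by force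
    have "v = (1, 0) \<or> v = (-1, 0) \<or> v = (0, 1) \<or> v = (0, -1)" using v by (simp add: dirs_def)
    then show ?thesis using c unfolding t_def w_def s
      apply (elim disjE)
         apply (simp_all add: turn_def)
         apply presburger+
      done
  qed
  ultimately show ?thesis by (simp add: t_def)
qed

section \<open>Beams as first returns to the rim\<close>

lemma along_Suc: "along s d (Suc k) = along s d k + d"
  by (cases s; cases d) (simp add: algebra_simps)

lemma trace_along:
  assumes "(s, v) \<in> half_edges" "\<And>j. 0 < j \<Longrightarrow> j \<le> k \<Longrightarrow> along s (turn s v) j \<notin> fst ` rim"
  shows "\<exists>u. (trace ^^ k) (s, v) = (along s (turn s v) k, u) \<and>
           turn (along s (turn s v) k) u = turn s v"
  using assms(2)
proof (induction k)
  case 0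
  then show ?case by (cases s; cases "turn s v") auto
next
  case (Suc k)
  let ?d = "turn s v"
  from Suc obtain u where u: "(trace ^^ k) (s, v) = (along s ?d k, u)" "turn (along s ?d k) u = ?d"
    by (metis le_SucI)
  have mem: "(along s ?d k, u) \<in> half_edges"
    using assms(1) u(1) by (metis permutes_in_funpow_image trace_permutes)
  have "along s ?d k + turn (along s ?d k) u \<notin> fst ` rim"
    using Suc.prems[of "Suc k"] u(2) by (simp add: along_Suc)
  have "(trace ^^ Suc k) (s, v) = trace (along s ?d k, u)" using u(1) by simp
  moreover have "fst (trace (along s ?d k, u)) = along s ?d (Suc k)"
    using fst_trace[OF mem] u(2) by (simp add: along_Suc)
  moreover have "turn (along s ?d (Suc k)) (snd (trace (along s ?d k, u))) = ?d"
    using trace_straight[OF mem \<open>_ \<notin> _\<close>] u(2) by (simp add: along_Suc)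
  ultimately show ?case by (metis prod.collapse)
qed

text \<open>In contrast to \<open>trace_along\<close>, the last point may lie on the rim: its
  position depends only on the direction before arrival.\<close>

lemma fst_trace_along:
  assumes "(s, v) \<in> half_edges" "\<And>j. 0 < j \<Longrightarrow> j < k \<Longrightarrow> along s (turn s v) j \<notin> fst ` rim"
  shows "fst ((trace ^^ k) (s, v)) = along s (turn s v) k"
proof (cases k)
  case 0
  then show ?thesis by (cases s; cases "turn s v") auto
next
  case (Suc m)
  then obtain u where u: "(trace ^^ m) (s, v) = (along s (turn s v) m, u)"
    "turn (along s (turn s v) m) u = turn s v" using trace_along[OF assms(1), of m] assms(2) by auto
  have "(along s (turn s v) m, u) \<in> half_edges"
    using assms(1) u(1) by (metis permutes_in_funpow_image trace_permutes)
  from fst_trace[OF this] show ?thesis using u Suc by (simp add: along_Suc)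
qed

text \<open>Otherwise the beam would pass through infinitely many different edges of a finite set.
  This makes the \<open>LEAST\<close> in \<open>billiard\<close> meaningful.\<close>

lemma beam_meets_rim:
  assumes "(s, v) \<in> half_edges"
  shows "\<exists>k>0. along s (turn s v) k \<in> fst ` rim"
proof (rule ccontr)
  assume no: "\<not> ?thesis"
  have "along s (turn s v) k \<in> fst ` half_edges" for k
  proof -
    have "fst ((trace ^^ k) (s, v)) = along s (turn s v) k"
      using no by (intro fst_trace_along[OF assms]) blast
    moreover have "(trace ^^ k) (s, v) \<in> half_edges"
      using assms by (metis permutes_in_funpow_image trace_permutes)
    ultimately show ?thesis by (metis imageI)
  qed
  then have "finite (range (along s (turn s v)))"
    using finite_half_edges by (meson finite_imageI finite_subset image_subsetI)
  moreover have "inj (along s (turn s v))"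
  proof -
    have "turn s v \<noteq> (0, 0)" using assms
      by (auto simp: half_edges_def dirs_def turn_def split: if_splits)
    then show ?thesis by (cases s; cases "turn s v") (auto simp: inj_on_def)
  qed
  ultimately show False using finite_imageD infinite_UNIV_nat by blast
qed

text \<open>The jump \<open>g\<close> is the first return of \<open>trace\<close> to
  \<open>rim\<close>, read through the injection \<open>fst\<close>. Every cycle of
  \<open>trace\<close> meets \<open>rim\<close>, since beams from interior half-edges reach it
  too.\<close>

lemma card_orbits_beams:
  assumes "\<And>s v. (s, v) \<in> rim \<Longrightarrow>
    g s = along s (turn s v) (LEAST k. k > 0 \<and> along s (turn s v) k \<in> fst ` rim)"
  shows "card (orbit g ` fst ` rim) = card (orbit trace ` half_edges)"
proof -
  \<comment> \<open>Whether a half-edge is on the rim depends on its edge alone, so positions along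
    the beam suffice to detect the return.\<close>
  have mem_rim: "h \<in> rim \<longleftrightarrow> fst h \<in> fst ` rim" if "h \<in> half_edges" for h
  proof
    assume "fst h \<in> fst ` rim"
    then obtain h' where "h' \<in> rim" "fst h = fst h'" by blast
    then show "h \<in> rim" using rim_unique[of "fst h" "snd h'" "snd h"] that by (metis prod.collapse)
  qed simp
  have ret: "\<exists>k>0. (trace ^^ k) (s, v) \<in> rim \<and>
      k = (LEAST k. k > 0 \<and> along s (turn s v) k \<in> fst ` rim) \<and>
      fst ((trace ^^ k) (s, v)) = along s (turn s v) k \<and>
      (\<forall>j. 0 < j \<and> j < k \<longrightarrow> (trace ^^ j) (s, v) \<notin> rim)" if h: "(s, v) \<in> half_edges" for s v
  proof -
    define k where "k = (LEAST k. k > 0 \<and> along s (turn s v) k \<in> fst ` rim)"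
    have k: "k > 0" "along s (turn s v) k \<in> fst ` rim"
      using LeastI_ex[OF beam_meets_rim[OF h]] by (auto simp: k_def)
    have less: "along s (turn s v) j \<notin> fst ` rim" if "0 < j" "j < k" for j
      using that not_less_Least unfolding k_def by blast
    have on: "fst ((trace ^^ j) (s, v)) = along s (turn s v) j" if "j \<le> k" for j
      using that less by (intro fst_trace_along[OF h]) auto
    have "(trace ^^ j) (s, v) \<in> half_edges" for j
      using h by (metis permutes_in_funpow_image trace_permutes)
    then show ?thesis using k less on mem_rim by (intro exI[of _ k]) (auto simp: k_def[symmetric])
  qed
  show ?thesis
  proof (rule card_orbits_first_return[OF trace_permutes finite_half_edges _ inj_on_rim])
    show "rim \<subseteq> half_edges" by (auto simp: rim_def)
  next
    fix h assume "h \<in> half_edges"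
    then show "orbit trace h \<inter> rim \<noteq> {}"
      using ret[of "fst h" "snd h"] by (auto simp: orbit_altdef)
  next
    fix h assume h: "h \<in> rim"
    obtain s v where sv: "h = (s, v)" by (cases h)
    have "(s, v) \<in> half_edges" using h sv by (simp add: rim_def)
    from ret[OF this] obtain k where k: "k > 0" "(trace ^^ k) h \<in> rim"
      "k = (LEAST k. k > 0 \<and> along s (turn s v) k \<in> fst ` rim)"
      "fst ((trace ^^ k) h) = along s (turn s v) k"
      "\<forall>j. 0 < j \<and> j < k \<longrightarrow> (trace ^^ j) h \<notin> rim" unfolding sv by blast
    have "g (fst h) = fst ((trace ^^ k) h)"
      using assms[OF h[unfolded sv], folded k(3)] k(4) sv by simp
    then show "\<exists>k>0. (trace ^^ k) h \<in> rim \<and> g (fst h) = fst ((trace ^^ k) h) \<and>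
        (\<forall>j. 0 < j \<and> j < k \<longrightarrow> (trace ^^ j) h \<notin> rim)"
      using k by blast
  qed
qed

end

section \<open>The region below a Dyck path\<close>

lemma pos_sum: "k \<le> length P \<Longrightarrow> fst (pos P k) + snd (pos P k) = int k"
proof -
  have "count_list xs E + count_list xs N = length xs" for xs
    by (induction xs) (auto intro: step.exhaust)
  from this[of "take k P"] show "k \<le> length P \<Longrightarrow> fst (pos P k) + snd (pos P k) = int k"
    by (simp add: pos_def flip: of_nat_add)
qed

text \<open>The doubled midpoint of step \<open>k\<close> has coordinate sum 2k + 1, so different
  steps have different midpoints.\<close>

lemma card_steps_of: "finite (steps_of P)" "card (steps_of P) = length P"
proof -
  let ?f = "\<lambda>k. pos P k + pos P (Suc k)"
  have eq: "steps_of P = ?f ` {..<length P}" by (auto simp: steps_of_def)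
  have "inj_on ?f {..<length P}"
  proof (rule inj_onI)
    fix k l assume "k \<in> {..<length P}" "l \<in> {..<length P}" "?f k = ?f l"
    then show "k = l"
      using pos_sum[of k P] pos_sum[of l P] pos_sum[of "Suc k" P] pos_sum[of "Suc l" P]
      by (simp add: prod_eq_iff)
  qed
  then show "finite (steps_of P)" "card (steps_of P) = length P"
    unfolding eq by (simp_all add: card_image)
qed

lemma count_list_take_Suc:
  "k < length P \<Longrightarrow> count_list (take (Suc k) P) a = count_list (take k P) a + (if P ! k = a then 1 else 0)"
  by (simp add: take_Suc_conv_app_nth)

lemma reflect_corner: "reflect (replicate n N @ replicate n E) = replicate n E @ replicate n N"
  by (simp add: reflect_def)

lemma count_list_replicate: "count_list (replicate n a) b = (if a = b then n else 0)"
  by (induction n) auto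

text \<open>The bottom and right sides of the square, which close the polygon when Q is N^n
  E^n.\<close>

lemma steps_of_corner:
  "steps_of (replicate n E @ replicate n N) =
     {(2 * int i + 1, 0) |i. i < n} \<union> {(2 * int n, 2 * int j + 1) |j. j < n}" (is "_ = ?R")
proof -
  let ?P = "replicate n E @ replicate n N"
  let ?f = "\<lambda>k. pos ?P k + pos ?P (Suc k)"
  have pos: "pos ?P k = (int (min k n), int (k - n))" if "k \<le> 2 * n" for k
    using that by (auto simp: pos_def count_list_replicate min_def)
  have "{..<2 * n} = {..<n} \<union> (\<lambda>j. n + j) ` {..<n}"
  proof (intro equalityI subsetI)
    fix k assume "k \<in> {..<2 * n}"
    then show "k \<in> {..<n} \<union> (\<lambda>j. n + j) ` {..<n}"
      by (cases "k < n") (auto intro: image_eqI[of _ _ "k - n"])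
  qed auto
  moreover have "steps_of ?P = ?f ` {..<2 * n}"
    unfolding steps_of_def image_def by (simp add: mult_2 Bex_def conj_commute)
  ultimately have "steps_of ?P = ?f ` ({..<n} \<union> (\<lambda>j. n + j) ` {..<n})" by simp
  also have "\<dots> = (\<lambda>i. (2 * int i + 1, 0)) ` {..<n} \<union> (\<lambda>j. (2 * int n, 2 * int j + 1)) ` {..<n}"
    unfolding image_Un image_image
    by (intro arg_cong2[where f = "(\<union>)"] image_cong) (auto simp: pos)
  finally show ?thesis by auto
qed

section \<open>North counts and steps of a Dyck path\<close>

locale dyck_path =
  fixes P :: "step list" and n :: nat
  assumes dyck: "P \<in> dyck n"
begin

definition norths :: "nat \<Rightarrow> nat" where
  "norths k = count_list (take k P) N"

lemma length_P: "length P = 2 * n"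
  using dyck by (simp add: dyck_def)

lemma norths_le: "norths k \<le> k"
  using count_le_length[of "take k P" N] by (simp add: norths_def)

lemma pos_norths: "k \<le> 2 * n \<Longrightarrow> pos P k = (int k - int (norths k), int (norths k))"
  using pos_sum[of k P] by (simp add: length_P prod_eq_iff pos_def norths_def)

lemma norths_dyck: "k \<le> 2 * n \<Longrightarrow> k \<le> 2 * norths k"
proof -
  assume k: "k \<le> 2 * n"
  then have "fst (pos P k) \<le> snd (pos P k)" using dyck by (simp add: dyck_def)
  then show ?thesis using pos_norths[OF k] by simp
qed

lemma norths_end: "norths (2 * n) = n"
  using dyck pos_norths[of "2 * n"] by (simp add: dyck_def)

lemma count_N: "count_list P N = n"
  using norths_end length_P by (simp add: norths_def)

lemma norths_Suc: "k < 2 * n \<Longrightarrow> norths (Suc k) = norths k + (if P ! k = N then 1 else 0)"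
  by (simp add: norths_def count_list_take_Suc length_P)

text \<open>No upper bound on \<open>k\<close> is required, as \<open>take\<close> saturates at the
  end of the path. Comparisons between the path and the cells under it rest on these two
  inequalities.\<close>

lemma norths_lip: "norths (k + l) \<le> norths k + l" "norths k \<le> norths (k + l)"
proof -
  have "norths k \<le> norths (Suc k) \<and> norths (Suc k) \<le> norths k + 1" for k
    using norths_Suc[of k] by (cases "k < 2 * n") (auto simp: norths_def length_P)
  then show "norths (k + l) \<le> norths k + l" "norths k \<le> norths (k + l)"
    by (induction l) (auto intro: le_trans order.trans[OF _ Suc_le_mono[THEN iffD2]])
qed

lemma norths_le_n: "norths k \<le> n"
proof -
  have "norths (2 * n + k) = n" by (simp add: norths_def length_P count_N)
  then show ?thesis using norths_lip(2)[of k "2 * n"] by (simp add: add.commute)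
qed

text \<open>A path can be at the lattice point (i, j) only after i + j steps. Membership of a given
  step thus becomes a condition on two consecutive values of \<open>norths\<close>, without a search
  for the index.\<close>

lemma north_step_iff:
  "(2 * int i, 2 * int j + 1) \<in> steps_of P \<longleftrightarrow>
     i + j < 2 * n \<and> norths (i + j) = j \<and> norths (Suc (i + j)) = Suc j" (is "?L \<longleftrightarrow> ?R")
proof
  assume ?L
  then obtain k where k: "k < 2 * n" "(2 * int i, 2 * int j + 1) = pos P k + pos P (Suc k)"
    by (auto simp: steps_of_def length_P)
  have "P ! k = N"
  proof (rule ccontr)
    assume "P ! k \<noteq> N"
    then have "2 * int j + 1 = 2 * int (norths k)" using k norths_Suc[of k] by (simp add: pos_norths)
    then show False by presburger
  qed
  then have "j = norths k" "int i = int k - int (norths k)"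
    using k norths_Suc[of k] by (simp_all add: pos_norths)
  moreover from this have "k = i + j" by linarith
  ultimately show ?R using k \<open>P ! k = N\<close> norths_Suc[of k] by simp
next
  assume ?R
  then show ?L unfolding steps_of_def
    by (auto simp: length_P pos_norths intro!: exI[of _ "i + j"])
qed

lemma east_step_iff:
  "(2 * int i + 1, 2 * int j) \<in> steps_of P \<longleftrightarrow>
     i + j < 2 * n \<and> norths (i + j) = j \<and> norths (Suc (i + j)) = j" (is "?L \<longleftrightarrow> ?R")
proof
  assume ?L
  then obtain k where k: "k < 2 * n" "(2 * int i + 1, 2 * int j) = pos P k + pos P (Suc k)"
    by (auto simp: steps_of_def length_P)
  have "P ! k \<noteq> N"
  proof
    assume "P ! k = N"
    then have "2 * int j = 2 * int (norths k) + 1" using k norths_Suc[of k] by (simp add: pos_norths)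
    then show False by presburger
  qed
  then have "j = norths k" "int i = int k - int (norths k)"
    using k norths_Suc[of k] by (simp_all add: pos_norths)
  moreover from this have "k = i + j" by linarith
  ultimately show ?R using k \<open>P ! k \<noteq> N\<close> norths_Suc[of k] by simp
next
  assume ?R
  then show ?L unfolding steps_of_def
    by (auto simp: length_P pos_norths intro!: exI[of _ "i + j"])
qed

lemma steps_of_cases:
  assumes "s \<in> steps_of P"
  obtains (north) i j where "s = (2 * int i, 2 * int j + 1)" | (east) i j where "s = (2 * int i + 1, 2 * int j)"
proof -
  from assms obtain k where k: "k < 2 * n" "s = pos P k + pos P (Suc k)"
    by (auto simp: steps_of_def length_P)
  show thesis
  proof (cases "P ! k = N")
    case True
    then show thesis using k norths_Suc[of k] norths_le[of k]
      by (intro north[of "k - norths k" "norths k"]) (simp add: pos_norths of_nat_diff)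
  next
    case False
    then show thesis using k norths_Suc[of k] norths_le[of k]
      by (intro east[of "k - norths k" "norths k"]) (simp add: pos_norths of_nat_diff)
  qed
qed

section \<open>The cells under the path and their number\<close>

definition corner :: "step list" where
  "corner = replicate n N @ replicate n E"

text \<open>The cell with lower left corner (i, j) has its other diagonal, from (i, j + 1) to (i +
  1, j), on the line x + y = i + j + 1. It lies under the path iff the path meets that line at
  height at least j + 1.\<close>

definition region :: "(int \<times> int) set" where
  "region = {(2 * int i + 1, 2 * int j + 1) |i j. i < n \<and> j < n \<and> j < norths (Suc (i + j))}"

lemma region_iff:
  "(2 * int i + 1, 2 * int j + 1) \<in> region \<longleftrightarrow> i < n \<and> j < n \<and> j < norths (Suc (i + j))"
  by (auto simp: region_def)

lemma regionE:
  assumes "c \<in> region"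
  obtains i j where "c = (2 * int i + 1, 2 * int j + 1)" "i < n" "j < n" "j < norths (Suc (i + j))"
  using assms by (auto simp: region_def)

lemma east_step_above:
  assumes "i < n" "j < norths (Suc (i + j))"
  obtains j' where "j < j'" "i + j' < 2 * n" "norths (i + j') = j'" "norths (Suc (i + j')) = j'"
proof -
  \<comment> \<open>The first moment with more than \<open>i\<close> east steps taken; the step just
    before it is the east step in column \<open>i\<close>.\<close>
  define k where "k = (LEAST k. k \<le> 2 * n \<and> i + norths k < k)"
  have k: "k \<le> 2 * n" "i + norths k < k"
    using LeastI[of "\<lambda>k. k \<le> 2 * n \<and> i + norths k < k" "2 * n"] assms(1) norths_end
    by (auto simp: k_def)
  then obtain l where l: "k = Suc l" by (cases k) auto
  have "\<not> (l \<le> 2 * n \<and> i + norths l < l)"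
    using not_less_Least[of l "\<lambda>k. k \<le> 2 * n \<and> i + norths k < k"] l by (simp add: k_def)
  then have "l \<le> i + norths l" using k l by auto
  with k norths_lip[of l 1] have l': "l = i + norths l" "norths (Suc l) = norths l"
    unfolding l by auto
  have "i + j < l"
  proof (rule ccontr)
    assume "\<not> i + j < l"
    then have "norths (Suc (i + j)) \<le> norths k + (i + j - l)"
      using norths_lip(1)[of k "i + j - l"] l by simp
    then show False using k l assms(2) \<open>\<not> i + j < l\<close> by simp
  qed
  then show thesis using that[of "norths l"] l' k l by auto
qed

lemma interior_cells_eq: "interior_cells P corner = region"
proof (intro equalityI subsetI)
  fix c assume "c \<in> interior_cells P corner"
  then obtain x y t b where c: "c = (x, y)" "odd x" "odd y" "t > y" "(x, t) \<in> steps_of P"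
    "b < y" "(x, b) \<in> steps_of (reflect corner)"
    by (auto simp: interior_cells_def)
  from c(2,7) obtain i where i: "x = 2 * int i + 1" "i < n" "b = 0"
    by (auto simp: corner_def reflect_corner steps_of_corner)
  have "(y - 1) div 2 \<ge> 0" "y = 2 * ((y - 1) div 2) + 1" using c(3,6) i by presburger+
  then obtain j where j: "y = 2 * int j + 1" by (metis nonneg_int_cases)
  from c(5) obtain j' where t: "t = 2 * int j'"
    by (cases rule: steps_of_cases) (use c(2) in auto)
  with c(5) i east_step_iff[of i j'] have j': "t = 2 * int j'" "norths (i + j') = j'" by auto
  have "j < j'" using c(4) j j' by simp
  then have "j < norths (Suc (i + j))"
    using norths_lip(1)[of "Suc (i + j)" "j' - Suc j"] j' by simp
  moreover have "j < n" using \<open>j < j'\<close> j' norths_le_n[of "i + j'"] by simp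
  ultimately show "c \<in> region" using c i j by (simp add: region_iff)
next
  fix c assume "c \<in> region"
  then obtain i j where c: "c = (2 * int i + 1, 2 * int j + 1)" "i < n" "j < n"
    "j < norths (Suc (i + j))" by (rule regionE)
  from east_step_above[OF c(2,4)] obtain j' where
    j': "j < j'" "i + j' < 2 * n" "norths (i + j') = j'" "norths (Suc (i + j')) = j'" .
  then have "(2 * int i + 1, 2 * int j') \<in> steps_of P" by (simp add: east_step_iff)
  moreover have "(2 * int i + 1, 0) \<in> steps_of (reflect corner)"
    using c(2) by (auto simp: corner_def reflect_corner steps_of_corner)
  ultimately show "c \<in> interior_cells P corner"
    using j'(1) unfolding interior_cells_def c(1)
    by (simp, intro conjI exI[of _ "2 * int j'"] exI[of _ 0]) auto
qed

text \<open>Cells are listed by columns: \<open>k - norths k\<close> is the column of the east step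
  \<open>k\<close>, and \<open>norths k\<close> its height.\<close>

lemma region_eq_image:
  "region = (\<lambda>(k, j). (2 * int (k - norths k) + 1, 2 * int j + 1)) `
     (SIGMA k:{k. k < 2 * n \<and> P ! k = E}. {..<norths k})" (is "_ = ?g ` ?S")
proof (intro equalityI subsetI)
  fix c assume "c \<in> region"
  then obtain i j where c: "c = (2 * int i + 1, 2 * int j + 1)" "i < n" "j < n"
    "j < norths (Suc (i + j))" by (rule regionE)
  from east_step_above[OF c(2,4)] obtain j' where
    j': "j < j'" "i + j' < 2 * n" "norths (i + j') = j'" "norths (Suc (i + j')) = j'" .
  then have "(i + j', j) \<in> ?S" using norths_Suc[of "i + j'"]
    by (auto intro: step.exhaust split: if_splits)
  moreover have "?g (i + j', j) = c" using c j' by simp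
  ultimately show "c \<in> ?g ` ?S" by force
next
  fix c assume "c \<in> ?g ` ?S"
  then obtain k j where k: "k < 2 * n" "P ! k = E" "j < norths k" and c: "c = ?g (k, j)" by auto
  define i where "i = k - norths k"
  have ki: "k = i + norths k" using norths_le[of k] by (simp add: i_def)
  \<comment> \<open>The east step ends on or above the diagonal, which places its column inside the
    square.\<close>
  have "Suc k \<le> 2 * norths k" using norths_dyck[of "Suc k"] norths_Suc[OF k(1)] k by simp
  then have "i < n" using ki norths_le_n[of k] by simp
  moreover have "j < n" using k norths_le_n[of k] by simp
  moreover have "j < norths (Suc (i + j))"
    using norths_lip(1)[of "Suc (i + j)" "norths k - Suc j"] k ki by simp
  ultimately show "c \<in> region" unfolding c by (simp add: region_iff i_def)
qed

lemma card_region: "card region = (\<Sum>k | k < 2 * n \<and> P ! k = E. norths k)"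
proof -
  have "k = l" if "k < 2 * n" "l < 2 * n" "P ! k = E" "P ! l = E" "k - norths k = l - norths l" for k l
    using that
  proof (induction k l rule: linorder_wlog)
    case (le k l)
    show ?case
    proof (rule ccontr)
      assume "k \<noteq> l"
      then have "norths l \<le> norths (Suc k) + (l - Suc k)"
        using norths_lip(1)[of "Suc k" "l - Suc k"] le by simp
      then show False using norths_Suc[of k] le \<open>k \<noteq> l\<close> norths_le[of k] norths_le[of l] by simp
    qed
  qed simp
  then have "inj_on (\<lambda>(k, j). (2 * int (k - norths k) + 1, 2 * int j + 1))
     (SIGMA k:{k. k < 2 * n \<and> P ! k = E}. {..<norths k})"
    by (auto simp: inj_on_def)
  then show ?thesis unfolding region_eq_image by (subst card_image) auto
qed

section \<open>The boundary of the grid polygon as the rim of its cells\<close>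

sublocale cells region
proof
  show "finite region" unfolding region_eq_image by auto
qed (auto simp: region_def)

text \<open>Links the boundary given by two paths with the edges that have the region on exactly one
  side. The converse inclusion reads off from the missing neighbour which path the edge belongs
  to.\<close>

lemma boundary_eq:
  "boundary P corner = {s. \<exists>v \<in> dirs. s + v \<in> region \<and> s - v \<notin> region}"
proof (intro equalityI subsetI)
  fix s assume "s \<in> boundary P corner"
  then consider "s \<in> steps_of P" | i where "s = (2 * int i + 1, 0)" "i < n"
    | j where "s = (2 * int n, 2 * int j + 1)" "j < n"
    by (auto simp: boundary_def corner_def reflect_corner steps_of_corner)
  then have "\<exists>v \<in> dirs. s + v \<in> region \<and> s - v \<notin> region"
  proof cases
    case 1
    then show ?thesis
    proof (cases rule: steps_of_cases)
      case (north i j)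
      with 1 have k: "i + j < 2 * n" "norths (i + j) = j" "norths (Suc (i + j)) = Suc j"
        by (simp_all add: north_step_iff)
      have "i < n" "j < n"
        using norths_dyck[of "i + j"] norths_le_n[of "Suc (i + j)"] k by auto
      then have "s + (1, 0) \<in> region" using k north by (simp add: region_iff)
      moreover have "s - (1, 0) \<notin> region"
      proof
        assume "s - (1, 0) \<in> region"
        then obtain i' j' where "s - (1, 0) = (2 * int i' + 1, 2 * int j' + 1)"
          "j' < norths (Suc (i' + j'))" by (rule regionE)
        moreover from this have "i = Suc i'" "j' = j" using north by auto
        ultimately show False using k by simp
      qed
      ultimately show ?thesis by (auto simp: dirs_def)
    next
      case (east i j)
      with 1 have k: "i + j < 2 * n" "norths (i + j) = j" "norths (Suc (i + j)) = j"
        by (simp_all add: east_step_iff)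
      have "i < j" "j \<le> n"
        using norths_dyck[of "Suc (i + j)"] norths_le_n[of "i + j"] k by auto
      then obtain j' where j: "j = Suc j'" by (cases j) auto
      have "s + (0, - 1) = (2 * int i + 1, 2 * int j' + 1)" using east j by simp
      moreover have "(2 * int i + 1, 2 * int j' + 1) \<in> region"
        using k j \<open>i < j\<close> \<open>j \<le> n\<close> by (simp add: region_iff)
      moreover have "s - (0, - 1) \<notin> region" using east k by (simp add: region_iff)
      ultimately show ?thesis by (auto simp: dirs_def)
    qed
  next
    case 2
    have "0 < norths (Suc i)" using norths_dyck[of "Suc i"] 2 by (cases "norths (Suc i)") auto
    then have "s + (0, 1) \<in> region" using 2 region_iff[of i 0] by simp
    moreover have "s - (0, 1) \<notin> region" using 2 by (auto simp: region_def)
    ultimately show ?thesis by (auto simp: dirs_def)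
  next
    case 3
    then obtain i where n: "n = Suc i" by (cases n) auto
    have "j < norths (n + j)" using norths_dyck[of "n + j"] 3 by auto
    have "s + (- 1, 0) = (2 * int i + 1, 2 * int j + 1)" using 3 n by simp
    moreover have "(2 * int i + 1, 2 * int j + 1) \<in> region"
      unfolding region_iff using 3 n \<open>j < norths (n + j)\<close> by simp
    ultimately have "s + (- 1, 0) \<in> region" by (simp only:)
    moreover have "s - (- 1, 0) \<notin> region" using 3 by (auto simp: region_def)
    ultimately show ?thesis by (auto simp: dirs_def)
  qed
  then show "s \<in> {s. \<exists>v \<in> dirs. s + v \<in> region \<and> s - v \<notin> region}" by simp
next
  fix s assume "s \<in> {s. \<exists>v \<in> dirs. s + v \<in> region \<and> s - v \<notin> region}"
  then obtain v where v: "v \<in> dirs" "s + v \<in> region" "s - v \<notin> region" by blast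
  from v(2) obtain i j where c: "s + v = (2 * int i + 1, 2 * int j + 1)" "i < n" "j < n"
    "j < norths (Suc (i + j))" by (rule regionE)
  then have s: "s = (2 * int i + 1, 2 * int j + 1) - v" by (metis add_diff_cancel_right')
  have corner: "(2 * int i + 1, 0) \<in> boundary P corner"
     "(2 * int n, 2 * int j + 1) \<in> boundary P corner"
    using c by (auto simp: boundary_def corner_def reflect_corner steps_of_corner)
  consider "v = (1, 0)" | "v = (- 1, 0)" | "v = (0, 1)" | "v = (0, - 1)"
    using v(1) by (auto simp: dirs_def)
  then show "s \<in> boundary P corner"
  proof cases
    case 1
    \<comment> \<open>The missing left neighbour bounds the path from above; in the first column the
      bound is trivial.\<close>
    have "norths (i + j) \<le> j"
    proof (cases i)
      case 0
      then show ?thesis using norths_le[of j] by simp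
    next
      case (Suc i')
      have "(2 * int i' + 1, 2 * int j + 1) \<notin> region" using v(3) s 1 Suc by (simp add: add.commute)
      then show ?thesis using c Suc by (simp add: region_iff)
    qed
    then have "norths (i + j) = j \<and> norths (Suc (i + j)) = Suc j"
      using c norths_lip(1)[of "i + j" 1] by simp
    then have "(2 * int i, 2 * int j + 1) \<in> steps_of P" using c by (simp add: north_step_iff)
    then show ?thesis using s 1 by (simp add: boundary_def)
  next
    case 2
    \<comment> \<open>Within the square the region is closed to the right, so only cells of the last
      column lack a right neighbour.\<close>
    have "\<not> Suc i < n"
    proof
      assume "Suc i < n"
      moreover have "(2 * int (Suc i) + 1, 2 * int j + 1) \<notin> region" using v(3) s 2 by simp
      ultimately show False using c norths_lip(2)[of "Suc (i + j)" 1] unfolding region_iff by simp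
    qed
    then have n: "Suc i = n" using c by simp
    have "s = (2 * int n, 2 * int j + 1)" using s 2 n by auto
    then show ?thesis using corner(2) by (simp only:)
  next
    case 3
    show ?thesis
    proof (cases j)
      case 0
      then show ?thesis using corner(1) s 3 by simp
    next
      \<comment> \<open>The region is closed downwards, so a cell above the bottom row has a lower
        neighbour and this case is contradictory.\<close>
      case (Suc j')
      have "(2 * int i + 1, 2 * int j' + 1) \<notin> region" using v(3) s 3 Suc by (simp add: add.commute)
      then show ?thesis using c Suc norths_lip(1)[of "i + j" 1] by (simp add: region_iff)
    qed
  next
    case 4
    have "norths (Suc (Suc (i + j))) \<le> Suc j"
    proof (cases "Suc j < n")
      case True
      have "(2 * int i + 1, 2 * int (Suc j) + 1) \<notin> region" using v(3) s 4 by simp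
      then show ?thesis using c True unfolding region_iff by simp
    next
      case False
      then show ?thesis using c norths_le_n[of "Suc (Suc (i + j))"] by simp
    qed
    then have "norths (i + Suc j) = Suc j \<and> norths (Suc (i + Suc j)) = Suc j"
      using c norths_lip(2)[of "Suc (i + j)" 1] by simp
    then have "(2 * int i + 1, 2 * int (Suc j)) \<in> steps_of P" using c by (simp only: east_step_iff) simp
    then show ?thesis using s 4 by (simp add: boundary_def)
  qed
qed

lemma boundary_eq_rim: "boundary P corner = fst ` rim"
proof (intro equalityI subsetI)
  fix s assume "s \<in> boundary P corner"
  then obtain v where "v \<in> dirs" "s + v \<in> region" "s - v \<notin> region"
    unfolding boundary_eq by blast
  then show "s \<in> fst ` rim"
    by (intro image_eqI[of _ _ "(s, v)"]) (simp_all add: rim_def half_edges_def)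
next
  fix s assume "s \<in> fst ` rim"
  then show "s \<in> boundary P corner"
    unfolding boundary_eq rim_def half_edges_def by blast
qed

text \<open>No step is shared: midpoints of steps of \<open>P\<close> lie strictly above the
  diagonal, those of the reflected corner path strictly below.\<close>

lemma card_boundary: "card (boundary P corner) = 4 * n"
proof -
  have "fst s < snd s" if "s \<in> steps_of P" for s
    using that
  proof (cases rule: steps_of_cases)
    case (north i j)
    with that show ?thesis using norths_dyck[of "i + j"] by (simp add: north_step_iff)
  next
    case (east i j)
    with that show ?thesis using norths_dyck[of "Suc (i + j)"] by (simp add: east_step_iff)
  qed
  moreover have "snd s < fst s" if "s \<in> steps_of (reflect corner)" for s
    using that by (auto simp: corner_def reflect_corner steps_of_corner)
  ultimately have "steps_of P \<inter> steps_of (reflect corner) = {}" by force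
  then show ?thesis unfolding boundary_def
    by (simp add: card_Un_disjoint card_steps_of length_P) (simp add: corner_def reflect_def)
qed

lemma inward_normal_rim:
  assumes "(s, v) \<in> rim"
  shows "inward_normal P corner s = v"
  unfolding inward_normal_def interior_cells_eq dirs_def[symmetric]
proof (rule the_equality)
  show "v \<in> dirs \<and> s + v \<in> region" using assms by (simp add: rim_def half_edges_def)
next
  fix u assume "u \<in> dirs \<and> s + u \<in> region"
  then show "u = v" using rim_unique[OF assms, of u] by (simp add: half_edges_def)
qed

lemma sign_traj: "(-1 :: int) ^ traj P = (-1) ^ (\<Sum>k | k < 2 * n \<and> P ! k = E. norths k)"
proof -
  have "traj P = card (orbit (billiard P corner) ` fst ` rim)"
    by (simp add: traj_def traj2_def count_N flip: corner_def boundary_eq_rim)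
  also have "\<dots> = card (orbit trace ` half_edges)"
  proof (rule card_orbits_beams)
    fix s v assume h: "(s, v) \<in> rim"
    then have "s \<in> fst ` rim" by force
    then show "billiard P corner s =
        along s (turn s v) (LEAST k. k > 0 \<and> along s (turn s v) k \<in> fst ` rim)"
      by (simp add: billiard_def boundary_eq_rim beam_dir_def inward_normal_rim[OF h])
  qed
  finally have trace: "(-1 :: int) ^ traj P = (-1) ^ (card region + card (fst ` half_edges))"
    using card_orbits_trace by simp
  have "card rim = 4 * n"
    using card_boundary card_image[OF inj_on_rim] by (simp add: boundary_eq_rim)
  \<comment> \<open>The number of edges is 2 \<open>card region\<close> + 2n, so it drops out of the
    exponent and only the cells remain.\<close>
  moreover have "even e" if "2 * e = 4 * c + r" "r = 4 * n" for e c r :: nat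
    using that by presburger
  ultimately have "even (card (fst ` half_edges))" using card_edges by blast
  with trace show ?thesis by (simp add: power_add card_region)
qed

end

section \<open>Motzkin paths as paired Dyck paths\<close>

text \<open>The area under a path that starts after \<open>a\<close> north steps, summed over the
  columns of its east steps.\<close>

fun below :: "nat \<Rightarrow> step list \<Rightarrow> nat" where
  "below a [] = 0"
| "below a (N # P) = below (Suc a) P"
| "below a (E # P) = a + below a P"

lemma sum_east_steps:
  "(\<Sum>k | k < length P \<and> P ! k = E. a + count_list (take k P) N) = below a P"
proof -
  have "(\<Sum>k<length P. if P ! k = E then a + count_list (take k P) N else 0) = below a P"
    by (induction a P rule: below.induct) (simp_all add: sum.lessThan_Suc_shift del: sum.lessThan_Suc cong: if_cong)
  moreover have "{k. k < length P \<and> P ! k = E} = {..<length P} \<inter> {k. P ! k = E}" by auto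
  ultimately show ?thesis by (simp add: sum.inter_restrict)
qed

lemma sign_traj_below:
  assumes "P \<in> dyck n"
  shows "(-1 :: int) ^ traj P = (-1) ^ below 0 P"
proof -
  interpret dyck_path P n using assms by unfold_locales
  show ?thesis using sign_traj sum_east_steps[of 0 P] by (simp add: length_P norths_def)
qed

lemma below_snoc_E: "below a (P @ [E]) = below a P + a + count_list P N"
  by (induction a P rule: below.induct) auto

section \<open>Recursive forms of the path conditions\<close>

fun dyck_from :: "nat \<Rightarrow> step list \<Rightarrow> bool" where
  "dyck_from h [] \<longleftrightarrow> h = 0"
| "dyck_from h (N # P) \<longleftrightarrow> dyck_from (Suc h) P"
| "dyck_from h (E # P) \<longleftrightarrow> h > 0 \<and> dyck_from (h - 1) P"

lemma all_le_Suc: "(\<forall>k\<le>Suc n. A k) \<longleftrightarrow> A 0 \<and> (\<forall>k\<le>n. A (Suc k))"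
  by (metis Suc_le_mono not0_implies_Suc le0)

lemma dyck_from_iff:
  "dyck_from h P \<longleftrightarrow> (\<forall>k\<le>length P. count_list (take k P) E \<le> h + count_list (take k P) N) \<and>
     count_list P E = h + count_list P N"
proof (induction h P rule: dyck_from.induct)
  case (3 h P)
  \<comment> \<open>The instance k = 0 gives \<open>h > 0\<close>, so the truncated
    \<open>h - 1\<close> is a true predecessor.\<close>
  have "(\<forall>k\<le>length P. Suc (count_list (take k P) E) \<le> h + count_list (take k P) N) \<Longrightarrow> h > 0"
    by (drule spec[of _ 0]) auto
  then show ?case using 3 by (cases h) (auto simp: all_le_Suc)
qed (auto simp: all_le_Suc)

lemma dyck_iff: "P \<in> dyck n \<longleftrightarrow> length P = 2 * n \<and> dyck_from 0 P"
proof (cases "length P = 2 * n")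
  case True
  have "int (count_list P E) + int (count_list P N) = 2 * int n"
    using pos_sum[of "length P" P] True by (simp add: pos_def)
  then show ?thesis using True by (auto simp: dyck_def dyck_from_iff pos_def)
qed (simp add: dyck_def)

text \<open>Such a path would reach the diagonal from below.\<close>

lemma dyck_from_snoc_N: "\<not> dyck_from h (P @ [N])"
  by (induction h P rule: dyck_from.induct) auto

fun motzkin_from :: "nat \<Rightarrow> mstep list \<Rightarrow> bool" where
  "motzkin_from h [] \<longleftrightarrow> h = 0"
| "motzkin_from h (U # M) \<longleftrightarrow> motzkin_from (Suc h) M"
| "motzkin_from h (H # M) \<longleftrightarrow> motzkin_from h M"
| "motzkin_from h (D # M) \<longleftrightarrow> h > 0 \<and> motzkin_from (h - 1) M"

fun riordan_from :: "nat \<Rightarrow> mstep list \<Rightarrow> bool" where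
  "riordan_from h [] \<longleftrightarrow> h = 0"
| "riordan_from h (U # M) \<longleftrightarrow> riordan_from (Suc h) M"
| "riordan_from h (H # M) \<longleftrightarrow> h > 0 \<and> riordan_from h M"
| "riordan_from h (D # M) \<longleftrightarrow> h > 0 \<and> riordan_from (h - 1) M"

lemma level_simps: "level M 0 = 0" "level (x # M) (Suc k) = rise x + level M k"
  by (simp_all add: level_def)

lemma motzkin_from_iff:
  "motzkin_from h M \<longleftrightarrow> (\<forall>k\<le>length M. int h + level M k \<ge> 0) \<and> int h + level M (length M) = 0"
proof (induction h M rule: motzkin_from.induct)
  case (4 h M)
  have "(\<forall>k\<le>length M. int h + (level M k - 1) \<ge> 0) \<Longrightarrow> h > 0"
    by (drule spec[of _ 0]) (auto simp: level_simps)
  then show ?case using 4 by (cases h) (auto simp: all_le_Suc level_simps algebra_simps)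
qed (auto simp: all_le_Suc level_simps algebra_simps)

lemma riordan_from_iff:
  "riordan_from h M \<longleftrightarrow>
     motzkin_from h M \<and> (\<forall>k<length M. M ! k = H \<longrightarrow> int h + level M k \<noteq> 0)"
proof (induction h M rule: riordan_from.induct)
  case (4 h M)
  then show ?case by (cases h) (auto simp: All_less_Suc2 level_simps algebra_simps)
qed (auto simp: All_less_Suc2 level_simps algebra_simps)

lemma motzkin_iff: "M \<in> motzkin n \<longleftrightarrow> length M = n \<and> motzkin_from 0 M"
  by (auto simp: motzkin_def motzkin_from_iff)

lemma riordan_iff: "M \<in> riordan n \<longleftrightarrow> length M = n \<and> riordan_from 0 M"
  by (auto simp: riordan_def motzkin_iff riordan_from_iff)

lemma motzkin_from_count: "motzkin_from h M \<Longrightarrow> count_list M D = h + count_list M U"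
  by (induction h M rule: motzkin_from.induct) auto

lemma finite_motzkin: "finite (motzkin n)" "finite (riordan n)"
proof -
  have "(UNIV :: mstep set) = {U, H, D}" by (auto intro: mstep.exhaust)
  then have "finite (UNIV :: mstep set)" by (metis finite.emptyI finite.insertI)
  from finite_subset[OF _ finite_lists_length_eq[OF this, of n]] show "finite (motzkin n)"
    by (auto simp: motzkin_def)
  then show "finite (riordan n)" by (simp add: riordan_def)
qed

section \<open>Paths read two steps at a time\<close>

fun pair :: "mstep \<Rightarrow> step list" where
  "pair U = [N, N]"
| "pair H = [E, N]"
| "pair D = [E, E]"

definition word :: "mstep list \<Rightarrow> step list" where
  "word M = concat (map pair M)"

lemma word_simps: "word [] = []" "word (x # M) = pair x @ word M"
  by (simp_all add: word_def)

lemma length_word: "length (word M) = 2 * length M"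
proof (induction M)
  case (Cons x M)
  then show ?case by (cases x) (simp_all add: word_simps)
qed (simp add: word_simps)

lemma word_inj: "word M = word M' \<Longrightarrow> M = M'"
proof (induction M arbitrary: M')
  case Nil
  then show ?case using length_word[of M'] by (simp add: word_simps)
next
  case (Cons x M)
  then obtain y L where M': "M' = y # L" using length_word[of "x # M"] length_word[of M'] by (cases M') auto
  show ?case using Cons unfolding M' by (cases x; cases y) (auto simp: word_simps)
qed

lemma count_N_word: "count_list (word M) N = 2 * count_list M U + count_list M H"
proof (induction M)
  case (Cons x M)
  then show ?case by (cases x) (simp_all add: word_simps)
qed (simp add: word_simps)

text \<open>Pairs change the height above the diagonal by 2, 0 or -2, so level \<open>h\<close>
  corresponds to height \<open>2 * h\<close>. On the diagonal EN would dip below, which is the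
  Riordan restriction on \<open>H\<close>.\<close>

lemma dyck_from_word: "dyck_from (2 * h) (word M) \<longleftrightarrow> riordan_from h M"
proof (induction h M rule: riordan_from.induct)
  case (3 h M)
  then show ?case by (cases h) (simp_all add: word_simps)
next
  case (4 h M)
  then show ?case by (cases h) (simp_all add: word_simps)
qed (simp_all add: word_simps)

text \<open>After an initial N the heights are \<open>2 * h + 1\<close>, so EN is harmless even at
  level 0 and the Riordan restriction disappears; the last E uses up the extra unit.\<close>

lemma dyck_from_word_E: "dyck_from (Suc (2 * h)) (word M @ [E]) \<longleftrightarrow> motzkin_from h M"
proof (induction h M rule: motzkin_from.induct)
  case (4 h M)
  then show ?case by (cases h) (simp_all add: word_simps)
qed (simp_all add: word_simps)

section \<open>Peaks and the parity of their positions\<close>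

definition ne_at :: "step list \<Rightarrow> nat \<Rightarrow> bool" where
  "ne_at P i \<longleftrightarrow> Suc i < length P \<and> P ! i = N \<and> P ! Suc i = E"

lemma ne_at_Cons_Suc: "ne_at (x # P) (Suc i) \<longleftrightarrow> ne_at P i"
  by (simp add: ne_at_def)

lemma ex_pair_iff: "(\<exists>z. [x, y] = pair z) \<longleftrightarrow> \<not> (x = N \<and> y = E)"
proof -
  have "(\<exists>z. Q z) \<longleftrightarrow> Q U \<or> Q H \<or> Q D" for Q by (metis mstep.exhaust)
  then show ?thesis by (cases x; cases y) simp_all
qed

text \<open>Every two-step block except NE is a pair, so the only obstruction is an NE that fills a
  block, that is, starts at an even position.\<close>

lemma ex_word_iff:
  assumes "even (length P)"
  shows "(\<exists>M. P = word M) \<longleftrightarrow> (\<forall>i. even i \<longrightarrow> \<not> ne_at P i)"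
  using assms
proof (induction P rule: induct_list012)
  case 1
  then show ?case using word_simps(1) by (auto simp: ne_at_def intro: exI[of _ "[]"])
next
  case (3 x y P)
  have "(\<forall>i. even i \<longrightarrow> \<not> ne_at (x # y # P) i) \<longleftrightarrow>
      \<not> (x = N \<and> y = E) \<and> (\<forall>i. even i \<longrightarrow> \<not> ne_at P i)" (is "?L \<longleftrightarrow> ?R")
  proof
    assume L: ?L
    then have "\<not> ne_at P i" if "even i" for i
      using that L[rule_format, of "Suc (Suc i)"] by (simp add: ne_at_Cons_Suc)
    then show ?R using L[rule_format, of 0] by (auto simp: ne_at_def)
  next
    assume R: ?R
    have "\<not> ne_at (x # y # P) i" if "even i" for i
    proof (cases "i = 0")
      case True
      then show ?thesis using R by (auto simp: ne_at_def)
    next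
      case False
      then have "i = Suc (Suc (i - 2))" using that by presburger
      then obtain j where "i = Suc (Suc j)" by blast
      then show ?thesis using R that by (simp add: ne_at_Cons_Suc)
    qed
    then show ?L by blast
  qed
  also have "\<dots> \<longleftrightarrow> (\<exists>z. [x, y] = pair z) \<and> (\<exists>M. P = word M)"
    using 3 by (simp add: ex_pair_iff)
  also have "\<dots> \<longleftrightarrow> (\<exists>M. x # y # P = word M)"
  proof
    assume "(\<exists>z. [x, y] = pair z) \<and> (\<exists>M. P = word M)"
    then obtain z M where "[x, y] = pair z" "P = word M" by blast
    then have "x # y # P = word (z # M)" by (simp add: word_simps flip: \<open>[x, y] = pair z\<close>)
    then show "\<exists>M. x # y # P = word M" by blast
  next
    assume "\<exists>M. x # y # P = word M"
    then obtain M where M: "x # y # P = word M" by blast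
    then obtain z L where "M = z # L" by (cases M) (auto simp: word_simps)
    with M have "[x, y] = pair z \<and> P = word L" by (cases z) (simp_all add: word_simps)
    then show "(\<exists>z. [x, y] = pair z) \<and> (\<exists>M. P = word M)" by blast
  qed
  finally show ?case by simp
qed auto

text \<open>The difference of the coordinates has the parity of their sum. The point of a peak comes
  one step after the position \<open>i\<close> of \<open>ne_at\<close>, so even height means odd
  \<open>i\<close>.\<close>

lemma even_height_pos:
  assumes "k \<le> length P"
  shows "even (height (pos P k)) \<longleftrightarrow> even k"
proof -
  have "even (y - x) \<longleftrightarrow> even k" if "x + y = int k" for x y
    using that by presburger
  then show ?thesis using pos_sum[OF assms] by (simp add: height_def)
qed

lemma peaks_iff: "(\<forall>p \<in> peaks P. Q p) \<longleftrightarrow> (\<forall>i. ne_at P i \<longrightarrow> Q (pos P (Suc i)))"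
  unfolding peaks_def ne_at_def by blast

lemma even_peaks_iff: "P \<in> dyck_even_peaks n \<longleftrightarrow> P \<in> dyck n \<and> (\<forall>i. even i \<longrightarrow> \<not> ne_at P i)"
proof -
  have "ne_at P i \<Longrightarrow> even (height (pos P (Suc i))) \<longleftrightarrow> odd i" for i
    by (subst even_height_pos) (auto simp: ne_at_def)
  then show ?thesis unfolding dyck_even_peaks_def by (auto simp: peaks_iff)
qed

lemma odd_peaks_iff: "P \<in> dyck_odd_peaks n \<longleftrightarrow> P \<in> dyck n \<and> (\<forall>i. odd i \<longrightarrow> \<not> ne_at P i)"
proof -
  have "ne_at P i \<Longrightarrow> even (height (pos P (Suc i))) \<longleftrightarrow> odd i" for i
    by (subst even_height_pos) (auto simp: ne_at_def)
  then show ?thesis unfolding dyck_odd_peaks_def by (auto simp: peaks_iff)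
qed

lemma dyck_even_peaks_eq: "dyck_even_peaks n = word ` riordan n"
proof (intro equalityI subsetI)
  fix P assume "P \<in> dyck_even_peaks n"
  then have P: "length P = 2 * n" "dyck_from 0 P" "\<forall>i. even i \<longrightarrow> \<not> ne_at P i"
    by (simp_all add: even_peaks_iff dyck_iff)
  then obtain M where "P = word M" using ex_word_iff[of P] by auto
  then show "P \<in> word ` riordan n"
    using P dyck_from_word[of 0 M] by (auto simp: riordan_iff length_word)
next
  fix P assume "P \<in> word ` riordan n"
  then obtain M where M: "P = word M" "M \<in> riordan n" by blast
  then show "P \<in> dyck_even_peaks n"
    using dyck_from_word[of 0 M] ex_word_iff[of P]
    by (auto simp: even_peaks_iff dyck_iff riordan_iff length_word)
qed

lemma ne_at_enclose:
  assumes "even (length P)"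
  shows "(\<forall>i. odd i \<longrightarrow> \<not> ne_at (N # P @ [E]) i) \<longleftrightarrow> (\<forall>i. even i \<longrightarrow> \<not> ne_at P i)"
proof -
  have "ne_at (N # P @ [E]) (Suc i) \<longleftrightarrow> ne_at P i" if "even i" for i
  proof -
    \<comment> \<open>The appended E can create a new NE only with the last step of
      \<open>P\<close>, at an index of the wrong parity.\<close>
    have "Suc i \<noteq> length P" using that assms by (metis even_Suc)
    then show ?thesis by (auto simp: ne_at_def nth_append)
  qed
  then show ?thesis by (metis even_Suc oddE Suc_eq_plus1 dvd_triv_left)
qed

lemma dyck_odd_peaks_eq: "dyck_odd_peaks (n + 1) = (\<lambda>M. N # word M @ [E]) ` motzkin n"
proof (intro equalityI subsetI)
  fix P assume "P \<in> dyck_odd_peaks (n + 1)"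
  then have P: "length P = 2 * n + 2" "dyck_from 0 P" "\<forall>i. odd i \<longrightarrow> \<not> ne_at P i"
    by (simp_all add: odd_peaks_iff dyck_iff)
  obtain x R where R: "P = x # R" "R \<noteq> []" using P(1) by (cases P) force+
  then obtain Q y where Q: "P = x # Q @ [y]" by (metis rev_exhaust)
  have "x = N" using P(2) Q by (cases x) auto
  moreover have "y = E" using P(2) Q dyck_from_snoc_N[of 0 "x # Q"] by (cases y) auto
  ultimately have Q: "P = N # Q @ [E]" using Q by simp
  then have "even (length Q)" using P(1) by simp
  then obtain M where M: "Q = word M" using ex_word_iff[of Q] ne_at_enclose[of Q] P(3) Q by auto
  then show "P \<in> (\<lambda>M. N # word M @ [E]) ` motzkin n"
    using P dyck_from_word_E[of 0 M] unfolding Q by (auto simp: motzkin_iff length_word)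
next
  fix P assume "P \<in> (\<lambda>M. N # word M @ [E]) ` motzkin n"
  then obtain M where M: "P = N # word M @ [E]" "M \<in> motzkin n" by blast
  then show "P \<in> dyck_odd_peaks (n + 1)"
    using dyck_from_word_E[of 0 M] ex_word_iff[of "word M"] ne_at_enclose[of "word M"]
    by (auto simp: odd_peaks_iff dyck_iff motzkin_iff length_word)
qed

section \<open>Parity of the area and signed counts\<close>

lemma even_below_word:
  "even (below a (word M)) \<longleftrightarrow> even (a * count_list M H + count_list M H div 2)"
proof (induction M arbitrary: a)
  case (Cons x M)
  \<comment> \<open>Only \<open>H\<close> matters modulo 2: \<open>U\<close> adds 2 to the base
    height and \<open>D\<close> adds two equal columns. With h letters \<open>H\<close> the area is
    a + (a + 1) + ... + (a + h - 1), and h(h - 1)/2 has the parity of h div 2; this is the induction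
    step for that fact.\<close>
  have half: "even (h + h div 2) \<longleftrightarrow> even (Suc h div 2)" for h :: nat by presburger
  show ?case
    using Cons[of "Suc (Suc a)"] Cons[of "Suc a"] Cons[of a] half[of "count_list M H"]
    by (cases x) (auto simp: word_simps)
qed (simp add: word_simps)

lemma motzkin_count_H: "M \<in> motzkin n \<Longrightarrow> n = 2 * count_list M U + count_list M H"
proof -
  assume M: "M \<in> motzkin n"
  have "length M = count_list M U + count_list M H + count_list M D"
  proof (induction M)
    case (Cons x M)
    then show ?case by (cases x) auto
  qed simp
  then show ?thesis using M motzkin_from_count[of 0 M] by (simp add: motzkin_iff)
qed

lemma sign_eqI: "even k = even l \<Longrightarrow> (-1 :: int) ^ k = (-1) ^ l"
  by (simp add: minus_one_power_iff)

lemma sign_traj_odd_peaks: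
  assumes "M \<in> motzkin n"
  shows "(-1 :: int) ^ traj (N # word M @ [E]) = (-1) ^ ((n + 2) div 2) * (-1) ^ count_list M U"
proof -
  have "N # word M @ [E] \<in> dyck (n + 1)"
    using dyck_odd_peaks_eq[of n] assms unfolding dyck_odd_peaks_def by blast
  then have "(-1 :: int) ^ traj (N # word M @ [E]) = (-1) ^ below (Suc 0) (word M @ [E])"
    by (simp add: sign_traj_below)
  \<comment> \<open>With u letters \<open>U\<close> and h letters \<open>H\<close> the area is h + h
    div 2 from the word plus 1 + 2u + h from the last E, modulo 2. As h = n - 2u, this leaves n div
    2 + 1 + u.\<close>
  also have "\<dots> = (-1) ^ ((n + 2) div 2 + count_list M U)"
    using motzkin_count_H[OF assms]
    by (intro sign_eqI) (simp add: below_snoc_E even_below_word count_N_word, presburger)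
  finally show ?thesis by (simp add: power_add)
qed

lemma sign_traj_even_peaks:
  assumes "M \<in> riordan n"
  shows "(-1 :: int) ^ traj (word M) = - ((-1) ^ ((n + 2) div 2) * (-1) ^ count_list M U)"
proof -
  have "word M \<in> dyck n"
    using dyck_even_peaks_eq[of n] assms unfolding dyck_even_peaks_def by blast
  then have "(-1 :: int) ^ traj (word M) = (-1) ^ below 0 (word M)"
    by (simp add: sign_traj_below)
  \<comment> \<open>The base height is 0, so the area is h div 2 = n div 2 - u modulo 2. No final E
    adds the extra 1, which accounts for the opposite sign.\<close>
  also have "\<dots> = (-1) ^ Suc ((n + 2) div 2 + count_list M U)"
    using motzkin_count_H[of M n] assms
    by (intro sign_eqI) (auto simp: even_below_word riordan_def)
  finally show ?thesis by (simp add: power_add)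
qed

lemma sum_sign_count_U:
  assumes "finite S"
  shows "(\<Sum>M\<in>S. (-1 :: int) ^ count_list M U) = int (num_even_up S) - int (num_odd_up S)"
proof -
  have "(\<Sum>M\<in>S. (-1 :: int) ^ count_list M U) =
      (\<Sum>M\<in>S. (if even (count_list M U) then 1 else 0) - (if odd (count_list M U) then 1 else 0))"
    by (intro sum.cong) auto
  also have "\<dots> = int (num_even_up S) - int (num_odd_up S)"
    using assms by (simp add: sum_subtractf num_even_up_def num_odd_up_def sum.If_cases Int_def)
  finally show ?thesis .
qed

theorem theorem1p4:
  fixes n :: nat
  assumes "n \<ge> 1"
  shows "(\<Sum>P \<in> dyck_odd_peaks (n + 1). (-1 :: int) ^ traj P) =
           (-1) ^ ((n + 2) div 2) * (int (num_even_up (motzkin n)) - int (num_odd_up (motzkin n)))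
       \<and> (\<Sum>P \<in> dyck_even_peaks n. (-1 :: int) ^ traj P) =
           (-1) ^ ((n + 2) div 2) * (int (num_odd_up (riordan n)) - int (num_even_up (riordan n)))"
proof
  have "inj_on (\<lambda>M. N # word M @ [E]) (motzkin n)" "inj_on word (riordan n)"
    by (auto simp: inj_on_def dest: word_inj)
  then have "(\<Sum>P \<in> dyck_odd_peaks (n + 1). (-1 :: int) ^ traj P) =
      (\<Sum>M \<in> motzkin n. (-1) ^ ((n + 2) div 2) * (-1) ^ count_list M U)"
    and "(\<Sum>P \<in> dyck_even_peaks n. (-1 :: int) ^ traj P) =
      (\<Sum>M \<in> riordan n. - ((-1) ^ ((n + 2) div 2) * (-1) ^ count_list M U))"
    unfolding dyck_odd_peaks_eq dyck_even_peaks_eq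
    by (simp_all add: sum.reindex sign_traj_odd_peaks sign_traj_even_peaks)
  then show "(\<Sum>P \<in> dyck_odd_peaks (n + 1). (-1 :: int) ^ traj P) =
      (-1) ^ ((n + 2) div 2) * (int (num_even_up (motzkin n)) - int (num_odd_up (motzkin n)))"
    and "(\<Sum>P \<in> dyck_even_peaks n. (-1 :: int) ^ traj P) =
      (-1) ^ ((n + 2) div 2) * (int (num_odd_up (riordan n)) - int (num_even_up (riordan n)))"
    using finite_motzkin[of n]
    by (simp_all only: sum_negf sum_sign_count_U flip: sum_distrib_left) (simp_all add: algebra_simps)
qed

end
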